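(* Let $k\ge 1$ and $m\ge 2$ be integers. (i) If $H\in\{H_1,H_2,H_3,H_4,H_5,H_6,H_{11}\}$ (the graphs on five vertices specified in the context), then $GR_k(H)\ge g(k)+1$, where \[g(k)=\begin{cases}(R_2(H)-1)\cdot 5^{(k-2)/2}, & \text{if } k \text{ is even},\\ 4\cdot 5^{(k-1)/2}, & \text{if } k \text{ is odd}.\end{cases}\] (ii) If $H=\widehat{K}_m$, then $GR_k(H)\ge g(k)+1$, where $g(1)=m$ and, for $k\ge 2$, \[g(k)=\begin{cases}(R_2(\widehat{K}_m)-1)\cdot 5^{(k-2)/2}, & \text{if } k \text{ is even and } m \text{ is odd},\\ R_2(\widehat{K}_m)+\frac{m}{2}\cdot(5^{k/2}-5)-1, & \text{if } k \text{ is even and } m \text{ is even},\\ \max\{2(R_2(\widehat{K}_m)-1),\,5m\}\cdot 5^{(k-3)/2}, & \text{if } k\ge 3 \text{ is odd}.\end{cases}\]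
   Context: All graphs are finite, simple and undirected. $K_n$ and $P_n$ denote the complete graph and the path on $n$ vertices. The kipas $\widehat{K}_m$ is the graph on $m+1$ vertices obtained from the join of $K_1$ and $P_m$ (a single vertex joined to all $m$ vertices of a path $P_m$). A $k$-edge coloring of $K_n$ is a map $c:E(K_n)\to\{1,\dots,k\}$ (not necessarily proper, not necessarily surjective). A triangle is rainbow if its three edges have pairwise different colors. A copy of $H$ means a (not necessarily induced) subgraph isomorphic to $H$; it is monochromatic if all its edges have the same color. For a graph $H$ and an integer $k\ge 1$, the Gallai-Ramsey number $GR_k(H)$ is the minimum integer $n$ such that every $k$-edge coloring of $K_n$ contains a rainbow triangle or a monochromatic copy of $H$. The Ramsey number $R_2(H)$ is the minimum integer $n$ such that every $2$-edge coloring of $K_n$ contains a monochromatic copy of $H$. The graphs $H_i$ in question all have vertex set $\{1,2,3,4,5\}$, with the following edge sets (writing $ij$ for the edge between $i$ and $j$): $H_1$: $12, 15, 25, 23, 34$ (a triangle with a path of length two attached at one vertex). $H_2$: $12, 15, 25, 23, 24$ (a triangle with two pendant edges at the same vertex). $H_3$: $12, 15, 25, 23, 45$ (a triangle with pendant edges at two different vertices). $H_4$: $12, 23, 34, 45, 15, 25$ (a $5$-cycle with one chord). $H_5$: $23, 25, 35, 34, 45, 12$ ($K_4$ minus an edge, with a pendant edge attached at a vertex of degree two). $H_6$: $23, 25, 35, 34, 45, 15$ ($K_4$ minus an edge, with a pendant edge attached at a vertex of degree three). $H_{11}$: $12, 23, 24, 15, 35, 45, 34$ ($K_{2,3}$ together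 with one edge joining two vertices of the part of size three). *)

theory Defs
  imports Complex_Main "HOL-Library.Ramsey"
begin

record 'a ugraph =
  verts :: "'a set"
  edges :: "'a set set"

definition simple_graph :: "'a ugraph \<Rightarrow> bool" where
  "simple_graph G \<longleftrightarrow> finite (verts G) \<and> edges G \<subseteq> [verts G]\<^bsup>2\<^esup>"

definition subgraph :: "'a ugraph \<Rightarrow> 'a ugraph \<Rightarrow> bool" where
  "subgraph G' G \<longleftrightarrow> simple_graph G' \<and> verts G' \<subseteq> verts G \<and> edges G' \<subseteq> edges G"

definition isomorphic :: "'a ugraph \<Rightarrow> 'b ugraph \<Rightarrow> bool" where
  "isomorphic G H \<longleftrightarrow>
     (\<exists>f. bij_betw f (verts G) (verts H) \<and> edges H = (\<lambda>e. f ` e) ` edges G)"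

definition complete_graph :: "'a set \<Rightarrow> 'a ugraph" where
  "complete_graph V = \<lparr>verts = V, edges = [V]\<^bsup>2\<^esup>\<rparr>"

definition path_graph :: "nat \<Rightarrow> nat ugraph" where
  "path_graph m = \<lparr>verts = {1..m}, edges = {{i, i + 1} |i. 1 \<le> i \<and> i < m}\<rparr>"

text \<open>The join is only meaningful for graphs with disjoint vertex sets.\<close>

definition graph_join :: "'a ugraph \<Rightarrow> 'a ugraph \<Rightarrow> 'a ugraph" where
  "graph_join G H =
     \<lparr>verts = verts G \<union> verts H,
      edges = edges G \<union> edges H \<union> {{u, v} |u v. u \<in> verts G \<and> v \<in> verts H}\<rparr>"

definition kipas :: "nat \<Rightarrow> nat ugraph" where
  "kipas m = graph_join (complete_graph {0}) (path_graph m)"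

definition edge_coloring :: "nat \<Rightarrow> 'a ugraph \<Rightarrow> ('a set \<Rightarrow> nat) \<Rightarrow> bool" where
  "edge_coloring k G c \<longleftrightarrow> c \<in> edges G \<rightarrow> {1..k}"

definition has_rainbow_triangle :: "'a ugraph \<Rightarrow> ('a set \<Rightarrow> nat) \<Rightarrow> bool" where
  "has_rainbow_triangle G c \<longleftrightarrow>
     (\<exists>x y z. distinct [x, y, z] \<and> {{x, y}, {y, z}, {x, z}} \<subseteq> edges G \<and>
              distinct [c {x, y}, c {y, z}, c {x, z}])"

definition has_mono_copy :: "'b ugraph \<Rightarrow> 'a ugraph \<Rightarrow> ('a set \<Rightarrow> nat) \<Rightarrow> bool" where
  "has_mono_copy H G c \<longleftrightarrow>
     (\<exists>H'. subgraph H' G \<and> isomorphic H H' \<and> (\<exists>i. \<forall>e \<in> edges H'. c e = i))"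

definition GR :: "nat \<Rightarrow> 'b ugraph \<Rightarrow> nat" where
  "GR k H = (LEAST n. \<forall>c. edge_coloring k (complete_graph {1..n}) c \<longrightarrow>
     has_rainbow_triangle (complete_graph {1..n}) c \<or> has_mono_copy H (complete_graph {1..n}) c)"

definition R2 :: "'b ugraph \<Rightarrow> nat" where
  "R2 H = (LEAST n. \<forall>c. edge_coloring 2 (complete_graph {1..n}) c \<longrightarrow>
     has_mono_copy H (complete_graph {1..n}) c)"

definition H1 :: "nat ugraph" where
  "H1 = \<lparr>verts = {1..5}, edges = {{1,2}, {1,5}, {2,5}, {2,3}, {3,4}}\<rparr>"

definition H2 :: "nat ugraph" where
  "H2 = \<lparr>verts = {1..5}, edges = {{1,2}, {1,5}, {2,5}, {2,3}, {2,4}}\<rparr>"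

definition H3 :: "nat ugraph" where
  "H3 = \<lparr>verts = {1..5}, edges = {{1,2}, {1,5}, {2,5}, {2,3}, {4,5}}\<rparr>"

definition H4 :: "nat ugraph" where
  "H4 = \<lparr>verts = {1..5}, edges = {{1,2}, {2,3}, {3,4}, {4,5}, {1,5}, {2,5}}\<rparr>"

definition H5 :: "nat ugraph" where
  "H5 = \<lparr>verts = {1..5}, edges = {{2,3}, {2,5}, {3,5}, {3,4}, {4,5}, {1,2}}\<rparr>"

definition H6 :: "nat ugraph" where
  "H6 = \<lparr>verts = {1..5}, edges = {{2,3}, {2,5}, {3,5}, {3,4}, {4,5}, {1,5}}\<rparr>"

definition H11 :: "nat ugraph" where
  "H11 = \<lparr>verts = {1..5}, edges = {{1,2}, {2,3}, {2,4}, {1,5}, {3,5}, {4,5}, {3,4}}\<rparr>"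

text \<open>The bounds are real-valued, so that only the exponents use truncated arithmetic; those
  are exact in the range where they are used (even \<open>k \<ge> 2\<close>, resp. odd \<open>k\<close>).\<close>

definition g_five :: "nat ugraph \<Rightarrow> nat \<Rightarrow> real" where
  "g_five H k =
     (if even k then (real (R2 H) - 1) * 5 ^ ((k - 2) div 2)
      else 4 * 5 ^ ((k - 1) div 2))"

definition g_kipas :: "nat \<Rightarrow> nat \<Rightarrow> real" where
  "g_kipas m k =
     (if k = 1 then real m
      else if even k \<and> odd m then (real (R2 (kipas m)) - 1) * 5 ^ ((k - 2) div 2)
      else if even k \<and> even m then
        real (R2 (kipas m)) + real m / 2 * (5 ^ (k div 2) - 5) - 1
      else max (2 * (real (R2 (kipas m)) - 1)) (5 * real m) * 5 ^ ((k - 3) div 2))"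

end

(* Each bound comes from a colouring built by substitution. Substituting a colouring into the blobs
   of the pentagon (K_5 split into two 5-cycles with two fresh colours) creates no rainbow triangle,
   and no monochromatic copy of a connected graph containing a triangle, since the pentagon has no
   monochromatic triangle; this multiplies the order by 5 at the cost of two colours. For the kipas
   with an even number m of spokes more is possible: a pentagon colour may be reused in one blob and
   a further one not joined to it in that colour, to form disjoint cliques on m/2 vertices. So four
   blobs carry a blow-up of a colouring without monochromatic triangles on 5^((k-2)/2) vertices into
   such cliques, and the fifth one carries the previous colouring. *)

theory Submission
  imports Defs
begin

section \<open>Symmetric binary colourings\<close>

text \<open>A colouring is a symmetric binary function rather than a function on two-element sets,
  so that substitution becomes a plain case distinction on pairs. The diagonal is left free.\<close>

definition gallai :: "nat \<Rightarrow> 'a set \<Rightarrow> ('a \<Rightarrow> 'a \<Rightarrow> nat) \<Rightarrow> bool" where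
  "gallai k V d \<longleftrightarrow>
     (\<forall>x\<in>V. \<forall>y\<in>V. x \<noteq> y \<longrightarrow> d x y \<in> {1..k} \<and> d x y = d y x) \<and>
     (\<forall>x\<in>V. \<forall>y\<in>V. \<forall>z\<in>V. distinct [x, y, z] \<longrightarrow> \<not> distinct [d x y, d y z, d x z])"

definition mono_copy :: "'b ugraph \<Rightarrow> 'a set \<Rightarrow> ('a \<Rightarrow> 'a \<Rightarrow> nat) \<Rightarrow> ('b \<Rightarrow> 'a) \<Rightarrow> nat \<Rightarrow> bool" where
  "mono_copy H V d f i \<longleftrightarrow>
     inj_on f (verts H) \<and> f ` verts H \<subseteq> V \<and> (\<forall>u v. {u, v} \<in> edges H \<longrightarrow> d (f u) (f v) = i)"

definition avoids :: "'b ugraph \<Rightarrow> 'a set \<Rightarrow> ('a \<Rightarrow> 'a \<Rightarrow> nat) \<Rightarrow> bool" where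
  "avoids H V d \<longleftrightarrow> (\<forall>f i. \<not> mono_copy H V d f i)"

text \<open>Fixing the vertex set \<open>{..<n}\<close> makes this a property of the order
  alone.\<close>

definition avoidable :: "nat \<Rightarrow> 'b ugraph \<Rightarrow> nat \<Rightarrow> bool" where
  "avoidable k H n \<longleftrightarrow> (\<exists>d :: nat \<Rightarrow> nat \<Rightarrow> nat. gallai k {..<n} d \<and> avoids H {..<n} d)"

lemma gallaiI:
  assumes "\<And>x y. x \<in> V \<Longrightarrow> y \<in> V \<Longrightarrow> x \<noteq> y \<Longrightarrow> d x y \<in> {1..k} \<and> d x y = d y x"
    and "\<And>x y z. x \<in> V \<Longrightarrow> y \<in> V \<Longrightarrow> z \<in> V \<Longrightarrow> distinct [x, y, z] \<Longrightarrow>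
           \<not> distinct [d x y, d y z, d x z]"
  shows "gallai k V d"
  using assms unfolding gallai_def by blast

lemma gallai_color: "gallai k V d \<Longrightarrow> x \<in> V \<Longrightarrow> y \<in> V \<Longrightarrow> x \<noteq> y \<Longrightarrow> d x y \<in> {1..k}"
  unfolding gallai_def by blast

lemma gallai_sym: "gallai k V d \<Longrightarrow> x \<in> V \<Longrightarrow> y \<in> V \<Longrightarrow> x \<noteq> y \<Longrightarrow> d x y = d y x"
  unfolding gallai_def by blast

lemma gallai_no_rainbow:
  "gallai k V d \<Longrightarrow> x \<in> V \<Longrightarrow> y \<in> V \<Longrightarrow> z \<in> V \<Longrightarrow> distinct [x, y, z] \<Longrightarrow>
    \<not> distinct [d x y, d y z, d x z]"
  unfolding gallai_def by blast

lemma gallai_pullback: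
  assumes "gallai k V d" "inj_on g W" "g ` W \<subseteq> V"
  shows "gallai k W (\<lambda>x y. d (g x) (g y))"
proof (rule gallaiI)
  fix x y assume "x \<in> W" "y \<in> W" "x \<noteq> y"
  moreover from this have "g x \<noteq> g y" "g x \<in> V" "g y \<in> V"
    using assms by (auto dest: inj_onD)
  ultimately show "d (g x) (g y) \<in> {1..k} \<and> d (g x) (g y) = d (g y) (g x)"
    using assms(1) gallai_color gallai_sym by metis
next
  fix x y z assume *: "x \<in> W" "y \<in> W" "z \<in> W" "distinct [x, y, z]"
  then have "g x \<in> V" "g y \<in> V" "g z \<in> V" "distinct [g x, g y, g z]"
    using assms by (auto dest: inj_onD)
  then show "\<not> distinct [d (g x) (g y), d (g y) (g z), d (g x) (g z)]"
    using gallai_no_rainbow[OF assms(1)] by blast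
qed

lemma avoids_pullback:
  assumes "avoids H V d" "inj_on g W" "g ` W \<subseteq> V"
  shows "avoids H W (\<lambda>x y. d (g x) (g y))"
  unfolding avoids_def
proof (intro allI notI)
  fix f i assume "mono_copy H W (\<lambda>x y. d (g x) (g y)) f i"
  then have "mono_copy H V d (g \<circ> f) i"
    using assms unfolding mono_copy_def
    by (auto intro: comp_inj_on inj_on_subset)
  then show False using assms(1) unfolding avoids_def by blast
qed

lemma gallai_mono:
  assumes "gallai k V d" "k \<le> l"
  shows "gallai l V d"
proof (rule gallaiI)
  fix x y assume *: "x \<in> V" "y \<in> V" "x \<noteq> y"
  show "d x y \<in> {1..l} \<and> d x y = d y x"
    using gallai_color[OF assms(1) *] gallai_sym[OF assms(1) *] assms(2) by simp
qed (rule gallai_no_rainbow[OF assms(1)])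

text \<open>Restriction along an injection from \<open>{..<n}\<close> standardises a colouring on
  any vertex type, such as pairs. As \<open>V\<close> may be larger than \<open>n\<close>, it also
  yields monotonicity in the order.\<close>

lemma avoidableI:
  assumes "gallai k V d" "avoids H V d" "finite V" "card V \<ge> n"
  shows "avoidable k H n"
proof -
  obtain g where "inj_on g {..<n}" "g ` {..<n} \<subseteq> V"
    using assms(3,4) card_le_inj[of "{..<n}" V] by auto
  then show ?thesis
    unfolding avoidable_def
    using gallai_pullback[OF assms(1)] avoids_pullback[OF assms(2)] by blast
qed

lemma simple_graph_edgeD:
  "simple_graph H \<Longrightarrow> {u, v} \<in> edges H \<Longrightarrow> u \<in> verts H \<and> v \<in> verts H \<and> u \<noteq> v"
  unfolding simple_graph_def by (metis doubleton_in_nsets_2 subsetD)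

lemma simple_graph_edgeE:
  assumes "simple_graph H" "e \<in> edges H"
  obtains u v where "e = {u, v}"
  using assms unfolding simple_graph_def by (meson nsets2_E subsetD)

text \<open>A simple graph has no loops and a copy is injective, so values on the diagonal never
  matter.\<close>

lemma mono_copy_cong:
  assumes "simple_graph H" "mono_copy H V d f i"
    and "\<And>x y. x \<in> V \<Longrightarrow> y \<in> V \<Longrightarrow> x \<noteq> y \<Longrightarrow> d' x y = d x y"
  shows "mono_copy H V d' f i"
  using assms unfolding mono_copy_def
  by (metis image_subset_iff inj_on_eq_iff simple_graph_edgeD)

text \<open>Replaces a subgraph with an isomorphism by an embedding. Images of edges are again
  two-element sets because \<open>H\<close> is simple and \<open>f\<close> is injective.\<close>

lemma has_mono_copy_iff:
  assumes "simple_graph H"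
  shows "has_mono_copy H (complete_graph V) c \<longleftrightarrow> (\<exists>f i. mono_copy H V (\<lambda>x y. c {x, y}) f i)"
proof
  assume "has_mono_copy H (complete_graph V) c"
  then obtain H' i f where H': "subgraph H' (complete_graph V)" "\<forall>e\<in>edges H'. c e = i"
    and f: "bij_betw f (verts H) (verts H')" "edges H' = (\<lambda>e. f ` e) ` edges H"
    unfolding has_mono_copy_def isomorphic_def by blast
  have "mono_copy H V (\<lambda>x y. c {x, y}) f i"
    unfolding mono_copy_def
  proof (intro conjI allI impI)
    show "inj_on f (verts H)" using f by (simp add: bij_betw_def)
    show "f ` verts H \<subseteq> V"
      using f H' by (auto simp: bij_betw_def subgraph_def complete_graph_def)
    fix u v assume "{u, v} \<in> edges H"
    then have "{f u, f v} \<in> edges H'"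
      unfolding f(2) by (metis image_empty image_eqI image_insert)
    then show "c {f u, f v} = i" using H' by blast
  qed
  then show "\<exists>f i. mono_copy H V (\<lambda>x y. c {x, y}) f i" by blast
next
  assume "\<exists>f i. mono_copy H V (\<lambda>x y. c {x, y}) f i"
  then obtain f i where f: "inj_on f (verts H)" "f ` verts H \<subseteq> V"
    and c: "\<And>u v. {u, v} \<in> edges H \<Longrightarrow> c {f u, f v} = i"
    unfolding mono_copy_def by blast
  define H' where "H' = \<lparr>verts = f ` verts H, edges = (\<lambda>e. f ` e) ` edges H\<rparr>"
  have E: "\<exists>u v. e = {f u, f v} \<and> {u, v} \<in> edges H \<and> u \<in> verts H \<and> v \<in> verts H \<and> f u \<noteq> f v"
    if "e \<in> edges H'" for e
  proof -
    from that obtain e' where e': "e = f ` e'" "e' \<in> edges H" by (auto simp: H'_def)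
    then obtain u v where "e' = {u, v}" using assms simple_graph_edgeE by metis
    with e' show ?thesis
      using simple_graph_edgeD[OF assms, of u v] f(1) by (auto dest: inj_onD)
  qed
  have "simple_graph H'"
    unfolding simple_graph_def
  proof
    show "finite (verts H')" using assms by (simp add: H'_def simple_graph_def)
    show "edges H' \<subseteq> [verts H']\<^bsup>2\<^esup>"
    proof
      fix e assume "e \<in> edges H'"
      from E[OF this] show "e \<in> [verts H']\<^bsup>2\<^esup>" by (auto simp: H'_def)
    qed
  qed
  moreover have "edges H' \<subseteq> [V]\<^bsup>2\<^esup>"
  proof
    fix e assume "e \<in> edges H'"
    from E[OF this] show "e \<in> [V]\<^bsup>2\<^esup>" using f(2) by (auto simp: image_subset_iff)
  qed
  ultimately have "subgraph H' (complete_graph V)"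
    using f(2) by (auto simp: subgraph_def complete_graph_def H'_def)
  moreover have "isomorphic H H'"
    unfolding isomorphic_def H'_def using f(1) by (auto simp: bij_betw_def)
  moreover have "\<forall>e\<in>edges H'. c e = i" using E c by blast
  ultimately show "has_mono_copy H (complete_graph V) c"
    unfolding has_mono_copy_def by blast
qed

section \<open>Ramsey numbers in terms of avoidable orders\<close>

lemma gallai_edge_coloring_iff:
  fixes c :: "'a set \<Rightarrow> nat"
  shows "gallai k V (\<lambda>x y. c {x, y}) \<longleftrightarrow>
    edge_coloring k (complete_graph V) c \<and> \<not> has_rainbow_triangle (complete_graph V) c"
proof -
  have "edge_coloring k (complete_graph V) c \<longleftrightarrow>
      (\<forall>x\<in>V. \<forall>y\<in>V. x \<noteq> y \<longrightarrow> c {x, y} \<in> {1..k} \<and> c {x, y} = c {y, x})"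
    unfolding edge_coloring_def complete_graph_def
    by (auto simp: insert_commute elim!: nsets2_E)
  moreover have "\<not> has_rainbow_triangle (complete_graph V) c \<longleftrightarrow>
      (\<forall>x\<in>V. \<forall>y\<in>V. \<forall>z\<in>V. distinct [x, y, z] \<longrightarrow> \<not> distinct [c {x, y}, c {y, z}, c {x, z}])"
    unfolding has_rainbow_triangle_def complete_graph_def by auto
  ultimately show ?thesis unfolding gallai_def by blast
qed

lemma avoidable_iff:
  assumes "simple_graph H"
  shows "avoidable k H n \<longleftrightarrow>
    (\<exists>c. edge_coloring k (complete_graph {1..n}) c \<and>
      \<not> has_rainbow_triangle (complete_graph {1..n}) c \<and> \<not> has_mono_copy H (complete_graph {1..n}) c)"
proof
  assume "avoidable k H n"
  then obtain d where d: "gallai k {..<n} d" "avoids H {..<n} d"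
    unfolding avoidable_def by blast
  define d' where "d' = (\<lambda>x y. d (x - 1) (y - 1))"
  have inj: "inj_on (\<lambda>x. x - 1) {1..n}" and sub: "(\<lambda>x. x - 1) ` {1..n} \<subseteq> {..<n}"
    by (auto simp: inj_on_def)
  have g: "gallai k {1..n} d'" and av: "avoids H {1..n} d'"
    unfolding d'_def
    using gallai_pullback[OF d(1) inj sub] avoids_pullback[OF d(2) inj sub] by simp_all
  \<comment> \<open>\<open>Min\<close> and \<open>Max\<close> choose an order of the two ends of an
    edge; the symmetry of \<open>d'\<close> makes the choice harmless.\<close>
  define c where "c = (\<lambda>e. d' (Min e) (Max e))"
  have c: "c {x, y} = d' x y" if "x \<in> {1..n}" "y \<in> {1..n}" "x \<noteq> y" for x y
    using gallai_sym[OF g that] by (cases "x < y") (auto simp: c_def min_def max_def)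
  have "gallai k {1..n} (\<lambda>x y. c {x, y})"
  proof (rule gallaiI)
    fix x y assume "x \<in> {1..n}" "y \<in> {1..n}" "x \<noteq> y"
    then show "c {x, y} \<in> {1..k} \<and> c {x, y} = c {y, x}"
      using c gallai_color[OF g] by (simp add: insert_commute)
  next
    fix x y z assume "x \<in> {1..n}" "y \<in> {1..n}" "z \<in> {1..n}" "distinct [x, y, z]"
    then show "\<not> distinct [c {x, y}, c {y, z}, c {x, z}]"
      using gallai_no_rainbow[OF g, of x y z] c by simp
  qed
  moreover have "\<not> mono_copy H {1..n} (\<lambda>x y. c {x, y}) f i" for f i
    using av mono_copy_cong[OF assms, of "{1..n}" "\<lambda>x y. c {x, y}" f i d'] c
    unfolding avoids_def by metis
  ultimately show "\<exists>c. edge_coloring k (complete_graph {1..n}) c \<and>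
      \<not> has_rainbow_triangle (complete_graph {1..n}) c \<and> \<not> has_mono_copy H (complete_graph {1..n}) c"
    using gallai_edge_coloring_iff has_mono_copy_iff[OF assms] by metis
next
  assume "\<exists>c. edge_coloring k (complete_graph {1..n}) c \<and>
      \<not> has_rainbow_triangle (complete_graph {1..n}) c \<and> \<not> has_mono_copy H (complete_graph {1..n}) c"
  then obtain c where "gallai k {1..n} (\<lambda>x y. c {x, y})" "avoids H {1..n} (\<lambda>x y. c {x, y})"
    unfolding avoids_def gallai_edge_coloring_iff has_mono_copy_iff[OF assms] by blast
  then show "avoidable k H n" by (rule avoidableI) auto
qed

lemma avoidable_antimono: "avoidable k H n \<Longrightarrow> n' \<le> n \<Longrightarrow> avoidable k H n'"
  unfolding avoidable_def by (metis avoidableI avoidable_def card_lessThan finite_lessThan)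

text \<open>A monochromatic clique on \<open>card (verts H)\<close> vertices contains
  \<open>H\<close>, so the finite Ramsey theorem applies. This guarantees that the
  \<open>LEAST\<close> in \<open>GR\<close> and in \<open>R2\<close> is attained.\<close>

lemma ramsey_not_avoidable:
  assumes "simple_graph H"
  shows "\<exists>N. \<not> avoidable k H N"
proof -
  let ?s = "card (verts H)"
  \<comment> \<open>Colours are list indices starting at 0, so \<open>Suc k\<close> entries
    accommodate the colours from 1 to \<open>k\<close>.\<close>
  obtain N where N: "partn_lst {..<N::nat} (replicate (Suc k) ?s) 2"
    using ramsey_full by blast
  have "\<not> avoidable k H N"
  proof
    assume "avoidable k H N"
    then obtain d where d: "gallai k {..<N} d" "avoids H {..<N} d"
      unfolding avoidable_def by blast
    define c where "c = (\<lambda>e. d (Min e) (Max e))"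
    have c: "c {x, y} = d x y" if "x < N" "y < N" "x \<noteq> y" for x y
      using gallai_sym[OF d(1), of x y] that by (cases "x < y") (auto simp: c_def min_def max_def)
    have "c \<in> [{..<N}]\<^bsup>2\<^esup> \<rightarrow> {..<Suc k}"
    proof
      fix e assume "e \<in> [{..<N}]\<^bsup>2\<^esup>"
      then obtain x y where "e = {x, y}" "x < N" "y < N" "x \<noteq> y" by (auto elim: nsets2_E)
      then show "c e \<in> {..<Suc k}" using c gallai_color[OF d(1), of x y] by auto
    qed
    then obtain i S where S: "i < Suc k" "S \<in> [{..<N}]\<^bsup>?s\<^esup>" "c ` [S]\<^bsup>2\<^esup> \<subseteq> {i}"
      using partn_lstE[OF N, of c "Suc k"] by (metis length_replicate nth_replicate)
    then obtain f where f: "bij_betw f (verts H) S"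
      using assms by (metis (mono_tags, lifting) finite_same_card_bij mem_Collect_eq nsets_def simple_graph_def)
    have "S \<subseteq> {..<N}" using S by (auto simp: nsets_def)
    moreover have "d (f u) (f v) = i" if "{u, v} \<in> edges H" for u v
    proof -
      have "f u \<in> S" "f v \<in> S" "f u \<noteq> f v"
        using simple_graph_edgeD[OF assms that] f by (auto simp: bij_betw_def dest: inj_onD)
      moreover from this have "c {f u, f v} = i"
        using image_subset_iff[THEN iffD1, OF S(3)] by simp
      ultimately show ?thesis using c \<open>S \<subseteq> {..<N}\<close> by (metis lessThan_iff subsetD)
    qed
    ultimately have "mono_copy H {..<N} d f i"
      using f by (auto simp: mono_copy_def bij_betw_def)
    then show False using d unfolding avoids_def by blast
  qed
  then show ?thesis by blast
qed

text \<open>\<open>GR\<close> is the least order that is not avoidable, and avoidability passes to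
  smaller orders.\<close>

lemma avoidable_less_GR:
  assumes "simple_graph H" "avoidable k H n"
  shows "n < GR k H"
proof -
  have GR: "GR k H = (LEAST n. \<not> avoidable k H n)"
    unfolding GR_def avoidable_iff[OF assms(1)] by (rule arg_cong[where f = Least]) blast
  have "\<not> avoidable k H (GR k H)"
    unfolding GR using ramsey_not_avoidable[OF assms(1)] by (rule LeastI_ex)
  then show ?thesis using assms(2) avoidable_antimono by (metis not_le)
qed

text \<open>Two colours cannot form a rainbow triangle, so \<open>R2\<close> is the least order not
  avoidable with two colours. Positivity makes the truncated \<open>R2 H - 1\<close> exact.\<close>

lemma avoidable_R2:
  assumes "simple_graph H" "verts H \<noteq> {}"
  shows "0 < R2 H \<and> avoidable 2 H (R2 H - 1)"
proof -
  have nr: "\<not> has_rainbow_triangle (complete_graph V) c" if "edge_coloring 2 (complete_graph V) c"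
    for V :: "nat set" and c
  proof
    assume "has_rainbow_triangle (complete_graph V) c"
    then obtain x y z where "{{x, y}, {y, z}, {x, z}} \<subseteq> edges (complete_graph V)"
      and *: "distinct [c {x, y}, c {y, z}, c {x, z}]"
      unfolding has_rainbow_triangle_def by blast
    then have "c {x, y} \<in> {1..2}" "c {y, z} \<in> {1..2}" "c {x, z} \<in> {1..2}"
      using that unfolding edge_coloring_def by blast+
    then show False using * by auto
  qed
  have R2: "R2 H = (LEAST n. \<not> avoidable 2 H n)"
    unfolding R2_def avoidable_iff[OF assms(1)]
    by (rule arg_cong[where f = Least]) (use nr in blast)
  have "\<not> avoidable 2 H (R2 H)"
    unfolding R2 using ramsey_not_avoidable[OF assms(1)] by (rule LeastI_ex)
  \<comment> \<open>The empty vertex set has no room for a copy, as \<open>H\<close> has a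
    vertex.\<close>
  moreover have "avoidable 2 H 0"
    using assms(2) by (auto simp: avoidable_def avoids_def mono_copy_def gallai_def)
  ultimately have pos: "0 < R2 H" by (metis gr0I)
  then show ?thesis using not_less_Least[of "R2 H - 1" "\<lambda>n. \<not> avoidable 2 H n"] R2 by auto
qed

section \<open>Substitution of colourings\<close>

text \<open>A pair consists of a blob and a vertex in it. The inner colouring may vary with the
  blob, as it does in the construction for even kipases.\<close>

definition substitute :: "('i \<Rightarrow> 'i \<Rightarrow> nat) \<Rightarrow> ('i \<Rightarrow> 'a \<Rightarrow> 'a \<Rightarrow> nat) \<Rightarrow> 'i \<times> 'a \<Rightarrow> 'i \<times> 'a \<Rightarrow> nat" where
  "substitute \<delta> d p q = (if fst p = fst q then d (fst p) (snd p) (snd q) else \<delta> (fst p) (fst q))"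

lemma substitute_simps [simp]:
  "fst p = fst q \<Longrightarrow> substitute \<delta> d p q = d (fst p) (snd p) (snd q)"
  "fst p \<noteq> fst q \<Longrightarrow> substitute \<delta> d p q = \<delta> (fst p) (fst q)"
  by (simp_all add: substitute_def)

text \<open>A triangle within one blob, or spread over three, inherits the property. If it meets
  exactly two blobs, its two edges between them share a colour.\<close>

lemma gallai_substitute:
  assumes o: "gallai k I \<delta>" and i: "\<And>i. i \<in> I \<Longrightarrow> gallai k (W i) (d i)"
  shows "gallai k (Sigma I W) (substitute \<delta> d)"
proof (rule gallaiI)
  fix p q assume *: "p \<in> Sigma I W" "q \<in> Sigma I W" "p \<noteq> q"
  obtain a x b y where pq: "p = (a, x)" "q = (b, y)"
    by (metis surj_pair)
  have m: "a \<in> I" "b \<in> I" "x \<in> W a" "y \<in> W b"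
    using * by (auto simp: pq)
  show "substitute \<delta> d p q \<in> {1..k} \<and> substitute \<delta> d p q = substitute \<delta> d q p"
  proof (cases "a = b")
    case True
    then show ?thesis
      using gallai_color[OF i[OF m(1)], of x y] gallai_sym[OF i[OF m(1)], of x y] m * by (auto simp: pq)
  next
    case False
    then show ?thesis
      using gallai_color[OF o m(1,2)] gallai_sym[OF o m(1,2)] by (auto simp: pq)
  qed
next
  fix p q r assume *: "p \<in> Sigma I W" "q \<in> Sigma I W" "r \<in> Sigma I W" "distinct [p, q, r]"
  obtain a x b y c z where pqr: "p = (a, x)" "q = (b, y)" "r = (c, z)"
    by (metis surj_pair)
  have m: "a \<in> I" "b \<in> I" "c \<in> I" "x \<in> W a" "y \<in> W b" "z \<in> W c"
    using * by (auto simp: pqr)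
  have s: "\<delta> u v = \<delta> v u" if "u \<in> I" "v \<in> I" "u \<noteq> v" for u v
    using gallai_sym[OF o that] .
  consider "a = b" "b = c" | "a = b" "b \<noteq> c" | "a \<noteq> b" "b = c" | "a \<noteq> b" "a = c" | "distinct [a, b, c]"
    by auto
  then show "\<not> distinct [substitute \<delta> d p q, substitute \<delta> d q r, substitute \<delta> d p r]"
  proof cases
    case 1
    then show ?thesis using gallai_no_rainbow[OF i[OF m(1)], of x y z] m * by (auto simp: pqr)
  next
    case 4
    then show ?thesis using s m by (auto simp: pqr)
  next
    case 5
    then show ?thesis using gallai_no_rainbow[OF o m(1,2,3)] by (auto simp: pqr)
  qed (auto simp: pqr)
qed

section \<open>Connected graphs with a triangle under substitution\<close>

definition connected_graph :: "'b ugraph \<Rightarrow> bool" where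
  "connected_graph H \<longleftrightarrow>
     (\<forall>P. (\<forall>u v. {u, v} \<in> edges H \<longrightarrow> P u \<longrightarrow> P v) \<longrightarrow>
       (\<forall>u\<in>verts H. \<forall>v\<in>verts H. P u \<longrightarrow> P v))"

text \<open>In a simple graph these edges force the three vertices to be distinct.\<close>

definition contains_triangle :: "'b ugraph \<Rightarrow> bool" where
  "contains_triangle H \<longleftrightarrow> (\<exists>x y z. {{x, y}, {y, z}, {x, z}} \<subseteq> edges H)"

definition mono_triangle_free :: "'a set \<Rightarrow> ('a \<Rightarrow> 'a \<Rightarrow> nat) \<Rightarrow> bool" where
  "mono_triangle_free V d \<longleftrightarrow>
     (\<forall>x\<in>V. \<forall>y\<in>V. \<forall>z\<in>V. distinct [x, y, z] \<longrightarrow> \<not> (d x y = d y z \<and> d y z = d x z))"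

text \<open>Connectivity is applied to a level set of \<open>\<phi>\<close>; its closure form is
  chosen for this and avoids walks.\<close>

lemma connected_graph_const:
  assumes "connected_graph H" "\<And>u v. {u, v} \<in> edges H \<Longrightarrow> \<phi> u = \<phi> v"
    "u \<in> verts H" "v \<in> verts H"
  shows "\<phi> u = \<phi> v"
  using assms(1)[unfolded connected_graph_def, rule_format, of "\<lambda>w. \<phi> u = \<phi> w"] assms by metis

text \<open>Otherwise the triangle of \<open>H\<close> would spread over three blobs and yield a
  monochromatic triangle of \<open>\<delta>\<close>.\<close>

lemma substitute_copy_has_inner_edge:
  assumes "simple_graph H" "contains_triangle H" "mono_triangle_free I \<delta>"
    "mono_copy H (Sigma I W) (substitute \<delta> d) f i"
  shows "\<exists>u v. {u, v} \<in> edges H \<and> fst (f u) = fst (f v)"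
proof (rule ccontr)
  assume *: "\<not> ?thesis"
  obtain x y z where e: "{x, y} \<in> edges H" "{y, z} \<in> edges H" "{x, z} \<in> edges H"
    using assms(2) unfolding contains_triangle_def by auto
  have fI: "fst (f u) \<in> I" if "u \<in> verts H" for u
    using assms(4) that unfolding mono_copy_def by (metis image_subset_iff mem_Sigma_iff prod.collapse)
  have "x \<in> verts H" "y \<in> verts H" "z \<in> verts H"
    using simple_graph_edgeD[OF assms(1) e(1)] simple_graph_edgeD[OF assms(1) e(2)] by simp_all
  then have "fst (f x) \<in> I" "fst (f y) \<in> I" "fst (f z) \<in> I"
    by (simp_all add: fI)
  moreover have ne: "fst (f x) \<noteq> fst (f y)" "fst (f y) \<noteq> fst (f z)" "fst (f x) \<noteq> fst (f z)"
    using * e(1) e(2) e(3) by metis+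
  moreover have "\<delta> (fst (f u)) (fst (f v)) = i" if "{u, v} \<in> edges H" "fst (f u) \<noteq> fst (f v)" for u v
    using assms(4) that by (metis mono_copy_def substitute_simps(2))
  from this[OF e(1) ne(1)] this[OF e(2) ne(2)] this[OF e(3) ne(3)]
  have "\<delta> (fst (f x)) (fst (f y)) = i" "\<delta> (fst (f y)) (fst (f z)) = i" "\<delta> (fst (f x)) (fst (f z)) = i" .
  ultimately show False
    using assms(3)[unfolded mono_triangle_free_def, rule_format, of "fst (f x)" "fst (f y)" "fst (f z)"]
    by simp
qed

text \<open>No edge of the copy can change the blob, since its colour does not occur between blobs;
  connectivity then keeps the whole copy together.\<close>

lemma substitute_copy_in_blob:
  assumes "simple_graph H" "connected_graph H" "mono_copy H (Sigma I W) (substitute \<delta> d) f i"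
    and "\<And>a b. a \<in> I \<Longrightarrow> b \<in> I \<Longrightarrow> a \<noteq> b \<Longrightarrow> \<delta> a b \<noteq> i" and "verts H \<noteq> {}"
  obtains a where "a \<in> I" "mono_copy H (W a) (d a) (snd \<circ> f) i" "\<forall>u\<in>verts H. fst (f u) = a"
proof -
  have fI: "f u \<in> Sigma I W" if "u \<in> verts H" for u
    using assms(3) that by (auto simp: mono_copy_def)
  have "fst (f u) = fst (f v)" if "{u, v} \<in> edges H" for u v
  proof (rule ccontr)
    assume ne: "fst (f u) \<noteq> fst (f v)"
    then have "\<delta> (fst (f u)) (fst (f v)) = i"
      using assms(3) that by (metis mono_copy_def substitute_simps(2))
    moreover have "fst (f u) \<in> I" "fst (f v) \<in> I"
      using simple_graph_edgeD[OF assms(1) that] fI by (auto dest!: fI)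
    ultimately show False using assms(4) ne by blast
  qed
  from connected_graph_const[OF assms(2), of "\<lambda>u. fst (f u)", OF this] assms(5)
  obtain a where a: "\<forall>u\<in>verts H. fst (f u) = a" by blast
  have "a \<in> I" using a fI assms(5) by fastforce
  moreover have "mono_copy H (W a) (d a) (snd \<circ> f) i"
    unfolding mono_copy_def
  proof (intro conjI allI impI)
    show "inj_on (snd \<circ> f) (verts H)"
      using a assms(3) by (auto simp: mono_copy_def inj_on_def prod_eq_iff)
    show "(snd \<circ> f) ` verts H \<subseteq> W a" using a fI by fastforce
    fix u v assume e: "{u, v} \<in> edges H"
    then have "substitute \<delta> d (f u) (f v) = i" using assms(3) by (auto simp: mono_copy_def)
    then show "d a ((snd \<circ> f) u) ((snd \<circ> f) v) = i"
      using a simple_graph_edgeD[OF assms(1) e] by auto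
  qed
  ultimately show thesis using a that by blast
qed

text \<open>The triangle of \<open>H\<close> forces an edge inside a blob, so the colour of a copy
  is at most \<open>k\<close>. Such colours do not join blobs, which confines the copy to one of
  them.\<close>

lemma avoids_substitute:
  assumes H: "simple_graph H" "connected_graph H" "contains_triangle H"
    and o: "mono_triangle_free I \<delta>" "\<And>a b. a \<in> I \<Longrightarrow> b \<in> I \<Longrightarrow> a \<noteq> b \<Longrightarrow> k < \<delta> a b"
    and i: "\<And>i. i \<in> I \<Longrightarrow> gallai k (W i) (d i)" "\<And>i. i \<in> I \<Longrightarrow> avoids H (W i) (d i)"
  shows "avoids H (Sigma I W) (substitute \<delta> d)"
  unfolding avoids_def
proof (intro allI notI)
  fix f c assume f: "mono_copy H (Sigma I W) (substitute \<delta> d) f c"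
  obtain u v where uv: "{u, v} \<in> edges H" "fst (f u) = fst (f v)"
    using substitute_copy_has_inner_edge[OF H(1,3) o(1) f] by blast
  then have u: "u \<in> verts H" "v \<in> verts H" "u \<noteq> v" using simple_graph_edgeD[OF H(1)] by auto
  then have "f u \<noteq> f v" "f u \<in> Sigma I W" "f v \<in> Sigma I W"
    using f by (auto simp: mono_copy_def dest: inj_onD)
  then have "snd (f u) \<noteq> snd (f v)" "fst (f u) \<in> I" "snd (f u) \<in> W (fst (f u))" "snd (f v) \<in> W (fst (f u))"
    using uv(2) by (auto simp: prod_eq_iff)
  moreover have "d (fst (f u)) (snd (f u)) (snd (f v)) = c"
    using uv f by (metis mono_copy_def substitute_simps(1))
  ultimately have "c \<le> k" using gallai_color[OF i(1)] by fastforce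
  then obtain a where "a \<in> I" "mono_copy H (W a) (d a) (snd \<circ> f) c"
    using substitute_copy_in_blob[OF H(1,2) f] o(2) u(1) by (metis empty_iff not_le)
  then show False using i(2) unfolding avoids_def by blast
qed

lemma avoidable_substitute:
  assumes H: "simple_graph H" "connected_graph H" "contains_triangle H"
    and I: "finite I" "gallai k' I \<delta>" "mono_triangle_free I \<delta>"
      "\<And>a b. a \<in> I \<Longrightarrow> b \<in> I \<Longrightarrow> a \<noteq> b \<Longrightarrow> k < \<delta> a b" "k \<le> k'"
    and "avoidable k H n"
  shows "avoidable k' H (card I * n)"
proof -
  obtain d where d: "gallai k {..<n} d" "avoids H {..<n} d"
    using assms(9) unfolding avoidable_def by blast
  show ?thesis
  proof (rule avoidableI)
    show "gallai k' (Sigma I (\<lambda>_. {..<n})) (substitute \<delta> (\<lambda>_. d))"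
      by (rule gallai_substitute[OF I(2) gallai_mono[OF d(1) I(5)]])
    show "avoids H (Sigma I (\<lambda>_. {..<n})) (substitute \<delta> (\<lambda>_. d))"
      by (rule avoids_substitute[OF H I(3) _ d]) (use I(4) in blast)
  qed (use I in auto)
qed

section \<open>Blow-ups of the pentagon\<close>

definition pentagon :: "nat \<Rightarrow> nat \<Rightarrow> nat \<Rightarrow> nat" where
  "pentagon k i j = (if j = (i + 1) mod 5 \<or> i = (j + 1) mod 5 then k + 1 else k + 2)"

lemma pentagon_color: "pentagon k i j \<in> {k + 1, k + 2}"
  by (simp add: pentagon_def)

lemma gallai_pentagon: "gallai (k + 2) {..<5} (pentagon k)"
proof (rule gallaiI)
  fix x y z
  show "\<not> distinct [pentagon k x y, pentagon k y z, pentagon k x z]"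
    using pentagon_color[of k x y] pentagon_color[of k y z] pentagon_color[of k x z] by auto
qed (auto simp: pentagon_def)

lemma lessThan_5: "{..<5::nat} = {0, 1, 2, 3, 4}"
  by auto

lemma mono_triangle_free_pentagon: "mono_triangle_free {..<5} (pentagon k)"
  unfolding mono_triangle_free_def lessThan_5 by (simp add: pentagon_def)

lemma avoidable_pentagon:
  assumes "simple_graph H" "connected_graph H" "contains_triangle H" "avoidable k H n"
  shows "avoidable (k + 2) H (5 * n)"
proof -
  have "k < pentagon k a b" for a b using pentagon_color[of k a b] by auto
  then show ?thesis
    using avoidable_substitute[OF assms(1-3) _ gallai_pentagon mono_triangle_free_pentagon, of k k n] assms(4)
    by simp
qed

lemma avoidable_pentagon_power:
  assumes "simple_graph H" "connected_graph H" "contains_triangle H" "avoidable k H n"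
  shows "avoidable (k + 2 * j) H (n * 5 ^ j)"
proof (induction j)
  case (Suc j)
  then show ?case using avoidable_pentagon[OF assms(1-3) Suc] by (simp add: mult.left_commute)
qed (use assms in simp)

text \<open>Two blobs are joined in one fresh colour; an outer colouring on two vertices has no
  triangle at all.\<close>

lemma avoidable_double:
  assumes "simple_graph H" "connected_graph H" "contains_triangle H" "avoidable k H n"
  shows "avoidable (k + 1) H (2 * n)"
proof -
  have "gallai (k + 1) {..<2::nat} (\<lambda>_ _. k + 1)" "mono_triangle_free {..<2::nat} (\<lambda>_ _. k + 1)"
    by (auto simp: gallai_def mono_triangle_free_def less_2_cases_iff)
  then show ?thesis
    using avoidable_substitute[OF assms(1-3), of "{..<2::nat}" "k + 1" _ k n] assms(4) by simp
qed

lemma avoidable_one_color: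
  assumes "finite (verts H)" "n < card (verts H)"
  shows "avoidable 1 H n"
proof -
  have "\<not> mono_copy H {..<n} (\<lambda>_ _. 1) f i" for f i
    using assms card_inj_on_le[of f "verts H" "{..<n}"] by (auto simp: mono_copy_def)
  then show ?thesis
    by (auto simp: avoidable_def avoids_def gallai_def intro!: exI[of _ "\<lambda>_ _. 1"])
qed

section \<open>Kipases with an even number of spokes\<close>

lemma kipas_verts [simp]: "verts (kipas m) = {0..m}"
  by (auto simp: kipas_def graph_join_def complete_graph_def path_graph_def)

lemma kipas_edges:
  "edges (kipas m) = {{i, i + 1} |i. 1 \<le> i \<and> i < m} \<union> {{0, v} |v. v \<in> {1..m}}"
proof -
  have "[{0::nat}]\<^bsup>2\<^esup> = {}" by (simp add: nsets_singleton_iff)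
  then show ?thesis
    by (auto simp: kipas_def graph_join_def complete_graph_def path_graph_def)
qed

lemma simple_graph_kipas: "simple_graph (kipas m)"
  unfolding simple_graph_def kipas_edges by auto

lemma kipas_spoke: "v \<in> {1..m} \<Longrightarrow> {0, v} \<in> edges (kipas m)"
  unfolding kipas_edges by blast

lemma kipas_rim: "1 \<le> i \<Longrightarrow> i < m \<Longrightarrow> {i, Suc i} \<in> edges (kipas m)"
  unfolding kipas_edges by auto

lemma connected_graph_kipas: "connected_graph (kipas m)"
  unfolding connected_graph_def
proof (intro allI impI ballI)
  fix P u v
  assume P: "\<forall>u v. {u, v} \<in> edges (kipas m) \<longrightarrow> P u \<longrightarrow> P v"
    and uv: "u \<in> verts (kipas m)" "v \<in> verts (kipas m)" "P u"
  have "P 0"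
    using P kipas_spoke[of u m] uv by (cases "u = 0") (auto simp: insert_commute)
  then show "P v"
    using P kipas_spoke[of v m] uv by (cases "v = 0") auto
qed

lemma contains_triangle_kipas:
  assumes "m \<ge> 2"
  shows "contains_triangle (kipas m)"
  unfolding contains_triangle_def
  using kipas_spoke[of 1 m] kipas_spoke[of 2 m] kipas_rim[of 1 m] assms
  by (intro exI[of _ 0] exI[of _ 1] exI[of _ 2]) (simp add: numeral_2_eq_2)

text \<open>A vertex cover of the path on \<open>2 h\<close> vertices contains an end of each of the \<open>h\<close> edges of
  its perfect matching.\<close>

lemma path_vertex_cover:
  fixes p :: "nat \<Rightarrow> 'a"
  assumes "inj_on p {1..2 * h}" "finite S"
    and "\<And>i. 1 \<le> i \<Longrightarrow> i < 2 * h \<Longrightarrow> p i \<in> S \<or> p (Suc i) \<in> S"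
  shows "h \<le> card S"
proof -
  \<comment> \<open>The matching edge number \<open>j\<close> joins \<open>2 * j + 1\<close> and
    \<open>2 * j + 2\<close>; \<open>g\<close> picks an end whose image lies in
    \<open>S\<close>.\<close>
  define g where "g = (\<lambda>j. if p (2 * j + 1) \<in> S then 2 * j + 1 else 2 * j + 2)"
  have "p (g j) \<in> S" if "j < h" for j
    using assms(3)[of "2 * j + 1"] that by (auto simp: g_def)
  moreover have "inj_on g {..<h}"
    by (rule inj_onI) (auto simp: g_def split: if_splits; presburger)
  moreover have "g ` {..<h} \<subseteq> {1..2 * h}"
    by (auto simp: g_def)
  ultimately have "(p \<circ> g) ` {..<h} \<subseteq> S" "inj_on (p \<circ> g) {..<h}"
    using assms(1) by (auto intro: comp_inj_on inj_on_subset)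
  then show ?thesis
    using card_inj_on_le[OF _ _ assms(2)] by fastforce
qed

lemma path_const:
  fixes q :: "nat \<Rightarrow> 'a"
  assumes "\<And>i. 1 \<le> i \<Longrightarrow> i < m \<Longrightarrow> q i = q (Suc i)" "i \<in> {1..m}"
  shows "q i = q 1"
proof -
  have "1 \<le> i \<Longrightarrow> i \<le> m \<Longrightarrow> q i = q 1"
    by (induction i rule: dec_induct) (use assms(1) in auto)
  then show ?thesis using assms(2) by simp
qed

text \<open>Colour \<open>c\<close> of the outer colouring \<open>\<delta>\<close> is reused inside some blobs, where it only forms
  cliques on \<open>h\<close> vertices. If the hub lies in such a blob, its own clique covers all edges within
  its neighbourhood; otherwise every path in its neighbourhood stays within one clique.\<close>

lemma no_kipas_in_reused_color:
  assumes o: "mono_triangle_free I \<delta>" "gallai k I \<delta>"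
    and S: "\<And>i j. i \<in> S \<Longrightarrow> j \<in> S \<Longrightarrow> i \<noteq> j \<Longrightarrow> \<delta> i j \<noteq> c" "S \<subseteq> I"
    and inner: "\<And>i t x s y. i \<in> I \<Longrightarrow> (t, x) \<in> W i \<Longrightarrow> (s, y) \<in> W i \<Longrightarrow> (t, x) \<noteq> (s, y) \<Longrightarrow>
        d i (t, x) (s, y) = c \<Longrightarrow> i \<in> S \<and> t = s"
    and W: "\<And>i t x. i \<in> S \<Longrightarrow> (t, x) \<in> W i \<Longrightarrow> x < h"
    and "h \<ge> 1"
  shows "\<not> mono_copy (kipas (2 * h)) (Sigma I W) (substitute \<delta> d) f c"
proof
  assume f: "mono_copy (kipas (2 * h)) (Sigma I W) (substitute \<delta> d) f c"
  let ?D = "substitute \<delta> d"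
  have inj: "inj_on f {0..2 * h}" using f by (simp add: mono_copy_def)
  have fI: "f i \<in> Sigma I W" if "i \<le> 2 * h" for i
    using f that by (auto simp: mono_copy_def)
  have hub: "?D (f 0) (f i) = c" if "1 \<le> i" "i \<le> 2 * h" for i
    using f kipas_spoke[of i "2 * h"] that by (auto simp: mono_copy_def)
  have rim: "?D (f i) (f (Suc i)) = c" if "1 \<le> i" "i < 2 * h" for i
    using f kipas_rim[of i "2 * h"] that by (auto simp: mono_copy_def)
  have ne: "f i \<noteq> f j" if "i \<le> 2 * h" "j \<le> 2 * h" "i \<noteq> j" for i j
    using inj that by (auto dest: inj_onD)
  have same: "fst (f i) \<in> S \<and> fst (snd (f i)) = fst (snd (f j))"
    if "i \<le> 2 * h" "j \<le> 2 * h" "i \<noteq> j" "?D (f i) (f j) = c" "fst (f i) = fst (f j)" for i j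
    using inner[of "fst (f i)" "fst (snd (f i))" "snd (snd (f i))" "fst (snd (f j))" "snd (snd (f j))"]
      fI[OF that(1)] fI[OF that(2)] ne[OF that(1,2,3)] that
    by (auto simp: prod_eq_iff)
  \<comment> \<open>Otherwise the hub and the two ends lie in three blobs and give a triangle of
    \<open>\<delta>\<close> in colour \<open>c\<close>.\<close>
  have rim_blob: "fst (f i) = fst (f (Suc i))"
    if "1 \<le> i" "i < 2 * h" "fst (f i) \<noteq> fst (f 0)" "fst (f (Suc i)) \<noteq> fst (f 0)" for i
  proof (rule ccontr)
    assume "fst (f i) \<noteq> fst (f (Suc i))"
    moreover have "fst (f 0) \<in> I" "fst (f i) \<in> I" "fst (f (Suc i)) \<in> I"
      using fI[of 0] fI[of i] fI[of "Suc i"] that by (auto simp: mem_Times_iff)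
    moreover have "\<delta> (fst (f 0)) (fst (f i)) = c" "\<delta> (fst (f 0)) (fst (f (Suc i))) = c"
      using hub[of i] hub[of "Suc i"] that by auto
    moreover have "\<delta> (fst (f i)) (fst (f (Suc i))) = c"
      using rim[OF that(1,2)] \<open>fst (f i) \<noteq> fst (f (Suc i))\<close> by simp
    ultimately show False
      using o(1)[unfolded mono_triangle_free_def, rule_format, of "fst (f 0)" "fst (f i)" "fst (f (Suc i))"]
        that by auto
  qed
  show False
  proof (cases "fst (f 0) \<in> S")
    case True
    \<comment> \<open>This is the clique of the hub without the hub. All rim vertices in the hub's
      blob lie here, and there are only \<open>h - 1\<close> places.\<close>
    define C where "C = {fst (f 0)} \<times> {fst (snd (f 0))} \<times> ({..<h} - {snd (snd (f 0))})"
    have inC: "f i \<in> C" if "1 \<le> i" "i \<le> 2 * h" "fst (f i) = fst (f 0)" for i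
    proof -
      have "fst (snd (f i)) = fst (snd (f 0))"
        using same[of 0 i] hub[OF that(1,2)] that by simp
      moreover have "snd (snd (f i)) < h"
        using W[OF True, of "fst (snd (f i))" "snd (snd (f i))"] fI[OF that(2)] that(3)
        by (metis SigmaE fst_conv prod.collapse snd_conv)
      moreover have "f i \<noteq> f 0" using ne[of i 0] that by simp
      ultimately show ?thesis using that(3) by (auto simp: C_def mem_Times_iff prod_eq_iff)
    qed
    \<comment> \<open>If both ends left the hub's blob, they would share a blob, which is in
      \<open>S\<close> because of their edge. But blobs of \<open>S\<close> are not joined in colour
      \<open>c\<close>, whereas the spokes have this colour.\<close>
    have "f i \<in> C \<or> f (Suc i) \<in> C" if i: "1 \<le> i" "i < 2 * h" for i
    proof (rule ccontr)
      assume "\<not> ?thesis"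
      then have n: "fst (f i) \<noteq> fst (f 0)" "fst (f (Suc i)) \<noteq> fst (f 0)"
        using inC[of i] inC[of "Suc i"] i by auto
      from rim_blob[OF i n] have "fst (f i) \<in> S"
        using same[of i "Suc i"] rim[OF i] i by simp
      then show False
        using S(1)[OF True, of "fst (f i)"] hub[of i] i n by (auto simp: substitute_def)
    qed
    moreover have "inj_on f {1..2 * h}" using inj by (rule inj_on_subset) auto
    moreover have "finite C" by (simp add: C_def)
    ultimately have "h \<le> card C" using path_vertex_cover by blast
    moreover have "snd (snd (f 0)) < h"
      using W[OF True, of "fst (snd (f 0))" "snd (snd (f 0))"] fI[of 0]
      by (metis SigmaE fst_conv le0 prod.collapse snd_conv)
    ultimately show False using \<open>h \<ge> 1\<close> by (simp add: C_def card_cartesian_product)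
  next
    case False
    \<comment> \<open>Colour \<open>c\<close> does not occur inside the hub's blob, so the whole rim
      lies outside it.\<close>
    have nb: "fst (f i) \<noteq> fst (f 0)" if "1 \<le> i" "i \<le> 2 * h" for i
    proof
      assume "fst (f i) = fst (f 0)"
      then show False using same[of 0 i] hub[OF that] that False by simp
    qed
    have step: "fst (f i) \<in> S \<and> fst (f i) = fst (f (Suc i)) \<and> fst (snd (f i)) = fst (snd (f (Suc i)))"
      if "1 \<le> i" "i < 2 * h" for i
      using rim_blob[OF that] nb[of i] nb[of "Suc i"] same[of i "Suc i"] rim[OF that] that by simp
    have const: "(fst (f i), fst (snd (f i))) = (fst (f 1), fst (snd (f 1)))" if "i \<in> {1..2 * h}" for i
      by (rule path_const[where q = "\<lambda>i. (fst (f i), fst (snd (f i)))", OF _ that]) (use step in auto)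
    have "fst (f 1) \<in> S" by (rule step[THEN conjunct1]) (use \<open>h \<ge> 1\<close> in auto)
    \<comment> \<open>All \<open>2 * h\<close> rim vertices would have to fit into one clique with
      \<open>h\<close> places.\<close>
    have "f i \<in> {fst (f 1)} \<times> {fst (snd (f 1))} \<times> {..<h}" if "i \<in> {1..2 * h}" for i
    proof -
      have "snd (snd (f i)) < h"
        using W[OF \<open>fst (f 1) \<in> S\<close>, of "fst (snd (f i))" "snd (snd (f i))"] fI[of i] const[OF that] that
        by auto
      then show ?thesis using const[OF that] by (auto simp: mem_Times_iff)
    qed
    then have "f ` {1..2 * h} \<subseteq> {fst (f 1)} \<times> {fst (snd (f 1))} \<times> {..<h}" by blast
    moreover have "inj_on f {1..2 * h}" using inj by (rule inj_on_subset) auto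
    ultimately have "2 * h \<le> h"
      using card_inj_on_le[of f "{1..2 * h}" "{fst (f 1)} \<times> {fst (snd (f 1))} \<times> {..<h}"]
      by (simp add: card_cartesian_product)
    then show False using \<open>h \<ge> 1\<close> by simp
  qed
qed

text \<open>\<open>kipas 2\<close> is the triangle, so results on avoidance specialise to colourings
  without monochromatic triangles.\<close>

lemma avoids_kipas_2_mono_triangle_free:
  assumes "avoids (kipas 2) V d" "gallai k V d"
  shows "mono_triangle_free V d"
  unfolding mono_triangle_free_def
proof (intro ballI impI notI)
  fix x y z assume *: "x \<in> V" "y \<in> V" "z \<in> V" "distinct [x, y, z]" "d x y = d y z \<and> d y z = d x z"
  define f where "f = (\<lambda>i::nat. if i = 0 then x else if i = 1 then y else z)"
  have s: "d y x = d x y" "d z y = d x y" "d z x = d x y"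
    using * gallai_sym[OF assms(2), of x y] gallai_sym[OF assms(2), of y z]
      gallai_sym[OF assms(2), of x z] by auto
  have "d (f u) (f v) = d x y" if "{u, v} \<in> edges (kipas 2)" for u v
  proof -
    from that consider i where "{u, v} = {i, i + 1}" "1 \<le> i" "i < 2"
      | w where "{u, v} = {0, w}" "1 \<le> w" "w \<le> 2"
      unfolding kipas_edges by auto
    then show ?thesis
    proof cases
      case 1
      then have "i = 1" by simp
      with 1(1) have "u = 1 \<and> v = 2 \<or> u = 2 \<and> v = 1" by (auto simp: doubleton_eq_iff)
      then show ?thesis using s *(5) by (auto simp: f_def)
    next
      case 2
      then have "w = 1 \<or> w = 2" by linarith
      then show ?thesis using 2(1) s *(5) by (auto simp: f_def doubleton_eq_iff)
    qed
  qed
  moreover have "{0..2::nat} = {0, 1, 2}" by auto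
  then have "inj_on f (verts (kipas 2))" "f ` verts (kipas 2) \<subseteq> V"
    using *(1-4) by (auto simp: f_def)
  ultimately have "mono_copy (kipas 2) V d f (d x y)"
    unfolding mono_copy_def by blast
  then show False using assms(1) unfolding avoids_def by blast
qed

text \<open>The pentagon is iterated with the triangle \<open>kipas 2\<close> as the forbidden
  graph, starting from a single vertex and no colours.\<close>

lemma mono_triangle_free_gallai_exists:
  "\<exists>\<tau> :: nat \<Rightarrow> nat \<Rightarrow> nat. gallai (2 * j) {..<5 ^ j} \<tau> \<and> mono_triangle_free {..<5 ^ j} \<tau>"
proof -
  have "avoidable 0 (kipas 2) 1"
    unfolding avoidable_def
  proof (intro exI conjI)
    show "gallai 0 {..<1::nat} (\<lambda>_ _. 0)" by (simp add: gallai_def)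
    show "avoids (kipas 2) {..<1::nat} (\<lambda>_ _. 0)"
      using card_inj_on_le[of _ "{0..2::nat}" "{..<1::nat}"]
      by (fastforce simp: avoids_def mono_copy_def)
  qed
  then have "avoidable (0 + 2 * j) (kipas 2) (1 * 5 ^ j)"
    by (intro avoidable_pentagon_power simple_graph_kipas connected_graph_kipas contains_triangle_kipas) simp_all
  then show ?thesis
    unfolding avoidable_def using avoids_kipas_2_mono_triangle_free by auto
qed

text \<open>Blob 1 keeps the old colouring and contains no cliques, so the value at 1 is irrelevant.\<close>

definition clique_color :: "nat \<Rightarrow> nat \<Rightarrow> nat" where
  "clique_color k i = (if i \<in> {0, 2} then k + 1 else k + 2)"

text \<open>Blobs 0 and 2 are joined in colour \<open>k + 2\<close> and hold cliques of colour
  \<open>k + 1\<close>; for blobs 3 and 4 the two colours are swapped.\<close>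

lemma clique_color_pentagon:
  assumes "i < 5" "j < 5" "i \<noteq> 1" "j \<noteq> 1" "i \<noteq> j" "clique_color k i = clique_color k j"
  shows "pentagon k i j \<noteq> clique_color k i"
proof -
  have "i \<in> {0, 2, 3, 4}" "j \<in> {0, 2, 3, 4}" using assms by auto
  then show ?thesis
    using assms(5,6) by (elim insertE emptyE; simp add: clique_color_def pentagon_def)
qed

text \<open>Colours up to \<open>2 * j\<close> do not join blobs, so a copy in such a colour stays
  in one blob, where the old colouring or the triangle-free one excludes it. The two new colours
  fall under \<open>no_kipas_in_reused_color\<close>.\<close>

lemma avoidable_kipas_even_step:
  assumes n: "avoidable (2 * j) (kipas (2 * h)) n" and h: "h \<ge> 1"
  shows "avoidable (2 * j + 2) (kipas (2 * h)) (n + 4 * (5 ^ j * h))"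
proof -
  let ?k = "2 * j" and ?H = "kipas (2 * h)"
  obtain d where d: "gallai ?k {..<n} d" "avoids ?H {..<n} d"
    using n unfolding avoidable_def by blast
  obtain \<tau> :: "nat \<Rightarrow> nat \<Rightarrow> nat" where \<tau>: "gallai ?k {..<5 ^ j} \<tau>" "mono_triangle_free {..<5 ^ j} \<tau>"
    using mono_triangle_free_gallai_exists by blast
  define T :: "nat \<Rightarrow> nat set" where "T = (\<lambda>i. if i = 1 then {..<n} else {..<5 ^ j})"
  \<comment> \<open>In blob 1 the cliques are singletons, so it is a copy of the old colouring of
    the same type as the other blobs.\<close>
  define X where "X = (\<lambda>i::nat. if i = 1 then {..<1::nat} else {..<h})"
  define W where "W = (\<lambda>i. T i \<times> X i)"
  define d\<^sub>i :: "nat \<Rightarrow> nat \<times> nat \<Rightarrow> nat \<times> nat \<Rightarrow> nat" where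
    "d\<^sub>i = (\<lambda>i. substitute (if i = 1 then d else \<tau>) (\<lambda>_ _ _. clique_color ?k i))"
  let ?D = "substitute (pentagon ?k) d\<^sub>i" and ?V = "Sigma {..<5} W"
  have T: "gallai ?k (T i) (if i = 1 then d else \<tau>)" for i
    using d \<tau> by (simp add: T_def)
  have inner: "gallai (?k + 2) (W i) (d\<^sub>i i)" for i
    unfolding W_def d\<^sub>i_def
  proof (rule gallai_substitute)
    show "gallai (?k + 2) (T i) (if i = 1 then d else \<tau>)"
      by (rule gallai_mono[OF T]) simp
    show "gallai (?k + 2) (X i) (\<lambda>_ _. clique_color ?k i)"
      by (auto simp: gallai_def clique_color_def)
  qed
  show ?thesis
  proof (rule avoidableI)
    show "gallai (?k + 2) ?V ?D"
      by (rule gallai_substitute[OF gallai_pentagon inner])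
    show "avoids ?H ?V ?D"
      unfolding avoids_def
    proof (intro allI)
      fix f c
      show "\<not> mono_copy ?H ?V ?D f c"
      proof (cases "c \<le> ?k")
        case False
        \<comment> \<open>The blobs whose cliques have colour \<open>c\<close>; there are none
          unless \<open>c\<close> is one of the two new colours.\<close>
        define S where "S = {i. i < 5 \<and> i \<noteq> 1 \<and> clique_color ?k i = c}"
        show ?thesis
        proof (rule no_kipas_in_reused_color[OF mono_triangle_free_pentagon gallai_pentagon, where S = S])
          fix i t x s y
          assume *: "i \<in> {..<5}" "(t, x) \<in> W i" "(s, y) \<in> W i" "(t, x) \<noteq> (s, y)" "d\<^sub>i i (t, x) (s, y) = c"
          have ts: "t = s"
          proof (rule ccontr)
            assume "t \<noteq> s"
            then show False
              using gallai_color[OF T, of t i s] * False by (auto simp: W_def d\<^sub>i_def)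
          qed
          moreover have "i \<noteq> 1" using * ts by (auto simp: W_def X_def)
          moreover have "clique_color ?k i = c" using * ts by (simp add: d\<^sub>i_def)
          ultimately show "i \<in> S \<and> t = s" using * by (simp add: S_def)
        next
          fix i i' assume "i \<in> S" "i' \<in> S" "i \<noteq> i'"
          then show "pentagon ?k i i' \<noteq> c"
            using clique_color_pentagon[of i i' ?k] by (simp add: S_def)
        qed (use h in \<open>auto simp: S_def W_def X_def\<close>)
      next
        case True
        show ?thesis
        proof
          assume f: "mono_copy ?H ?V ?D f c"
          have "pentagon ?k a b \<noteq> c" for a b
            using pentagon_color[of ?k a b] True by auto
          then obtain a where a: "a < 5" "mono_copy ?H (W a) (d\<^sub>i a) (snd \<circ> f) c"
            using substitute_copy_in_blob[OF simple_graph_kipas connected_graph_kipas f]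
            by (metis atLeastAtMost_iff empty_iff kipas_verts le0 lessThan_iff)
          have "clique_color ?k a \<noteq> c" using True by (auto simp: clique_color_def)
          \<comment> \<open>Edges within a clique have a new colour while \<open>c\<close> is old,
            so adjacent vertices lie in different cliques.\<close>
          have outer: "fst (snd (f u)) \<noteq> fst (snd (f v))" if e: "{u, v} \<in> edges ?H" for u v
          proof
            assume "fst (snd (f u)) = fst (snd (f v))"
            then have "clique_color ?k a = d\<^sub>i a (snd (f u)) (snd (f v))" by (simp add: d\<^sub>i_def)
            also have "\<dots> = c" using a(2) e by (simp add: mono_copy_def)
            finally show False using \<open>clique_color ?k a \<noteq> c\<close> by simp
          qed
          show False
          proof (cases "a = 1")
            case True
            have "mono_copy ?H {..<n} d (fst \<circ> (snd \<circ> f)) c"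
              unfolding mono_copy_def
            proof (intro conjI allI impI)
              show "inj_on (fst \<circ> (snd \<circ> f)) (verts ?H)"
              proof (rule comp_inj_on)
                show "inj_on (snd \<circ> f) (verts ?H)" using a(2) by (simp add: mono_copy_def)
                have "inj_on fst (W a)" using True by (auto simp: inj_on_def W_def X_def)
                then show "inj_on fst ((snd \<circ> f) ` verts ?H)"
                  using a(2) by (auto simp: mono_copy_def intro: inj_on_subset)
              qed
              show "(fst \<circ> (snd \<circ> f)) ` verts ?H \<subseteq> {..<n}"
                using a(2) True by (auto simp: mono_copy_def W_def T_def image_subset_iff)
              fix u v assume e: "{u, v} \<in> edges ?H"
              then have "d\<^sub>i a (snd (f u)) (snd (f v)) = c" using a(2) by (simp add: mono_copy_def)
              then show "d ((fst \<circ> (snd \<circ> f)) u) ((fst \<circ> (snd \<circ> f)) v) = c"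
                using True outer[OF e] by (simp add: d\<^sub>i_def)
            qed
            then show False using d unfolding avoids_def by blast
          next
            case a1: False
            \<comment> \<open>Since \<open>\<tau>\<close> has no monochromatic triangle, the
              triangle of the kipas forces an edge within a clique, against
              \<open>outer\<close>.\<close>
            have "mono_copy ?H (Sigma {..<5 ^ j} (\<lambda>_. X a)) (substitute \<tau> (\<lambda>_ _ _. clique_color ?k a)) (snd \<circ> f) c"
              using a(2) a1 by (simp add: W_def T_def d\<^sub>i_def)
            from substitute_copy_has_inner_edge[OF simple_graph_kipas _ \<tau>(2) this]
            show False using outer h contains_triangle_kipas[of "2 * h"] by auto
          qed
        qed
      qed
    qed
    show "finite ?V" by (auto simp: W_def T_def X_def)
    have "card ?V = (\<Sum>i<5. card (W i))" by (simp add: W_def T_def X_def)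
    also have "\<dots> = n + 4 * (5 ^ j * h)"
      by (simp add: W_def T_def X_def card_cartesian_product lessThan_5)
    finally show "n + 4 * (5 ^ j * h) \<le> card ?V" by simp
  qed
qed


text \<open>The gains \<open>4 * h * 5 ^ i\<close> for \<open>i\<close> from 1 to \<open>j\<close>
  add up to \<open>h * (5 ^ (j + 1) - 5)\<close>; for \<open>j = 0\<close> nothing is
  gained.\<close>

lemma avoidable_kipas_even:
  assumes "avoidable 2 (kipas (2 * h)) n" "h \<ge> 1"
  shows "avoidable (2 * (j + 1)) (kipas (2 * h)) (n + h * (5 ^ (j + 1) - 5))"
proof (induction j)
  case (Suc j)
  have le: "5 \<le> (5::nat) ^ (j + 1)" by simp
  have "n + h * (5 ^ (j + 1) - 5) + 4 * (5 ^ (j + 1) * h) = n + h * (5 ^ (Suc j + 1) - 5)"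
  proof -
    \<comment> \<open>Writing the power as \<open>5 + w\<close> removes the truncated
      subtraction.\<close>
    obtain w where w: "5 ^ (j + 1) = 5 + (w :: nat)" using le le_Suc_ex by blast
    have w': "5 ^ (Suc j + 1) = 5 * (5 + w)" by (simp flip: w)
    show ?thesis unfolding w w' by (simp add: algebra_simps)
  qed
  then show ?case
    using avoidable_kipas_even_step[OF Suc assms(2)] by (metis add_mult_distrib2 nat_mult_1_right one_add_one plus_1_eq_Suc add.commute)
qed (use assms in simp)

section \<open>The lower bounds\<close>

lemma five_vertex_graphs:
  assumes "H \<in> {H1, H2, H3, H4, H5, H6, H11}"
  shows "simple_graph H" "verts H = {1..5}" "connected_graph H" "contains_triangle H"
proof -
  have V: "{1..5} = {1, 2, 3, 4, 5::nat}" by auto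
  note defs = H1_def H2_def H3_def H4_def H5_def H6_def H11_def
  show "verts H = {1..5}" using assms by (auto simp: defs)
  show "simple_graph H" using assms by (auto simp: defs simple_graph_def)
  \<comment> \<open>An edge transfers \<open>P\<close> in both directions, and the resulting
    equivalences link all five vertices in each graph.\<close>
  have chain: "P 1 \<longleftrightarrow> P 2" "P 2 \<longleftrightarrow> P 3" "P 3 \<longleftrightarrow> P 4" "P 4 \<longleftrightarrow> P 5"
    if "\<forall>u v. {u, v} \<in> edges H \<longrightarrow> P u \<longrightarrow> P v" for P
  proof -
    have P: "P u \<longleftrightarrow> P v" if "{u, v} \<in> edges H" for u v
      using \<open>\<forall>u v. {u, v} \<in> edges H \<longrightarrow> P u \<longrightarrow> P v\<close> that by (metis insert_commute)
    have "(P 1 \<longleftrightarrow> P 2) \<and> (P 2 \<longleftrightarrow> P 3) \<and> (P 3 \<longleftrightarrow> P 4) \<and> (P 4 \<longleftrightarrow> P 5)"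
      using assms P[of 1 2] P[of 1 5] P[of 2 5] P[of 2 3] P[of 3 4] P[of 2 4] P[of 4 5] P[of 3 5]
      by (elim insertE emptyE; simp add: defs doubleton_eq_iff)
    then show "P 1 \<longleftrightarrow> P 2" "P 2 \<longleftrightarrow> P 3" "P 3 \<longleftrightarrow> P 4" "P 4 \<longleftrightarrow> P 5" by auto
  qed
  show "connected_graph H"
    unfolding connected_graph_def \<open>verts H = {1..5}\<close> V
  proof (intro allI impI ballI)
    fix P and u v :: nat
    assume P: "\<forall>u v. {u, v} \<in> edges H \<longrightarrow> P u \<longrightarrow> P v"
      and uv: "u \<in> {1, 2, 3, 4, 5}" "v \<in> {1, 2, 3, 4, 5}" "P u"
    show "P v"
      using uv chain(1)[OF P] chain(2)[OF P] chain(3)[OF P] chain(4)[OF P] by auto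
  qed
  show "contains_triangle H"
  proof -
    \<comment> \<open>The first triangle serves \<open>H1\<close> to \<open>H4\<close>, the second
      \<open>H5\<close> and \<open>H6\<close>, the third \<open>H11\<close>.\<close>
    have "{{1, 2}, {2, 5}, {1, 5}} \<subseteq> edges H \<or> {{2, 3}, {3, 5}, {2, 5}} \<subseteq> edges H \<or>
        {{2, 3}, {3, 4}, {2, 4}} \<subseteq> edges H"
      using assms by (elim insertE emptyE; simp add: defs)
    then show ?thesis unfolding contains_triangle_def by blast
  qed
qed

text \<open>Pentagons are iterated on a starting colouring: an extremal one with two colours for
  even \<open>k\<close>, a monochromatic complete graph on 4 vertices for odd
  \<open>k\<close>.\<close>

lemma GR_gt_g_five:
  assumes "H \<in> {H1, H2, H3, H4, H5, H6, H11}" "k \<ge> 1"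
  shows "g_five H k + 1 \<le> real (GR k H)"
proof -
  note H = five_vertex_graphs[OF assms(1)]
  show ?thesis
  proof (cases "even k")
    case True
    then have "\<exists>j. k = 2 + 2 * j" using assms(2) by presburger
    then obtain j where k: "k = 2 + 2 * j" ..
    have R2: "0 < R2 H" "avoidable 2 H (R2 H - 1)" using avoidable_R2[OF H(1)] H(2) by auto
    then have "(R2 H - 1) * 5 ^ j < GR k H"
      unfolding k using H by (intro avoidable_less_GR avoidable_pentagon_power)
    then have "real ((R2 H - 1) * 5 ^ j) + 1 \<le> real (GR k H)"
      by linarith
    then show ?thesis using R2(1) by (simp add: g_five_def k)
  next
    case False
    then obtain j where k: "k = 1 + 2 * j" by (metis oddE add.commute)
    have "4 * 5 ^ j < GR k H"
      unfolding k using H by (intro avoidable_less_GR avoidable_pentagon_power avoidable_one_color) auto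
    then have "real (4 * 5 ^ j) + 1 \<le> real (GR k H)" by linarith
    then show ?thesis by (simp add: g_five_def k)
  qed
qed

text \<open>For odd \<open>k \<ge> 3\<close> there are two starts with three colours: a doubled
  extremal 2-colouring, and a pentagon of monochromatic complete graphs on \<open>m\<close>
  vertices. The better one gives the maximum.\<close>

lemma GR_gt_g_kipas:
  assumes "m \<ge> 2" "k \<ge> 1"
  shows "g_kipas m k + 1 \<le> real (GR k (kipas m))"
proof -
  let ?H = "kipas m" and ?r = "R2 (kipas m) - 1"
  note H = simple_graph_kipas[of m] connected_graph_kipas[of m] contains_triangle_kipas[OF assms(1)]
  have R2: "real ?r = real (R2 ?H) - 1" "avoidable 2 ?H ?r"
    using avoidable_R2[OF simple_graph_kipas, of m] by auto
  have one: "avoidable 1 ?H m" by (rule avoidable_one_color) auto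
  have GR: "real n + 1 \<le> real (GR k ?H)" if "avoidable k ?H n" for n
    using avoidable_less_GR[OF H(1) that] by linarith
  consider "k = 1" | j where "k = 2 + 2 * j" "odd m" | j h where "k = 2 * (j + 1)" "m = 2 * h"
    | j where "k = 3 + 2 * j"
  proof -
    have "k = 1 \<or> (\<exists>j. k = 2 + 2 * j) \<or> (\<exists>j. k = 3 + 2 * j)"
      using assms(2) by presburger
    moreover have "odd m \<or> (\<exists>h. m = 2 * h)" by blast
    ultimately show thesis using that by (metis add_mult_distrib2 mult.right_neutral add.commute)
  qed
  then show ?thesis
  proof cases
    case 1
    then show ?thesis using GR one by (simp add: g_kipas_def)
  next
    case (2 j)
    then show ?thesis
      using GR[of "?r * 5 ^ j"] avoidable_pentagon_power[OF H R2(2), of j] R2(1)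
      by (simp add: g_kipas_def)
  next
    case (3 j h)
    \<comment> \<open>The power is at least 5, so the truncated difference agrees with the real
      one.\<close>
    have "5 ^ 1 \<le> (5::nat) ^ (j + 1)" by (rule power_increasing) auto
    then have "real (5 ^ (j + 1) - 5) = 5 ^ (j + 1) - 5" by simp
    moreover have "avoidable k ?H (?r + h * (5 ^ (j + 1) - 5))"
      using avoidable_kipas_even R2(2) assms(1) 3 by simp
    ultimately show ?thesis
      using GR[of "?r + h * (5 ^ (j + 1) - 5)"] R2(1) 3 by (simp add: g_kipas_def)
  next
    case (4 j)
    have "avoidable (2 + 1) ?H (2 * ?r)"
      by (rule avoidable_double[OF H R2(2)])
    then have "avoidable k ?H (2 * ?r * 5 ^ j)"
      unfolding 4 by (intro avoidable_pentagon_power H) simp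
    note double = GR[OF this]
    have "avoidable 3 ?H (5 * m)"
      using avoidable_pentagon[OF H one] by (simp add: numeral_3_eq_3)
    then have "avoidable k ?H (5 * m * 5 ^ j)"
      unfolding 4 by (intro avoidable_pentagon_power H) simp
    note five = GR[OF this]
    have "g_kipas m k = max (2 * (real (R2 ?H) - 1)) (5 * real m) * 5 ^ j"
      by (simp add: g_kipas_def 4)
    then show ?thesis using double five R2(1) by (simp add: max_def)
  qed
qed

theorem mainTheorem3:
  fixes k m :: nat
  assumes "k \<ge> 1" and "m \<ge> 2"
  shows "(\<forall>H \<in> {H1, H2, H3, H4, H5, H6, H11}. real (GR k H) \<ge> g_five H k + 1) \<and>
         real (GR k (kipas m)) \<ge> g_kipas m k + 1"
  using GR_gt_g_five GR_gt_g_kipas assms by blast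

end
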